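(* The invariants $\mathrm{ccat}$ and $\mathrm{cTC}$ are homotopy invariant: if $\mathcal{C}$ and $\mathcal{C}'$ are homotopy equivalent small connected categories, then $\mathrm{ccat}(\mathcal{C})=\mathrm{ccat}(\mathcal{C}')$ and $\mathrm{cTC}(\mathcal{C})=\mathrm{cTC}(\mathcal{C}')$.
   Context: Interval category: for $m\ge 0$, $\mathcal{I}_m$ has objects $0,1,\dots,m$ and its only non-identity arrows are: exactly one arrow $r\to s$ whenever $r$ is even and $s=r-1$ or $s=r+1$. Two functors $F,G\colon\mathcal{C}\to\mathcal{D}$ between small categories are homotopic, $F\simeq G$, if for some $m\ge 0$ there is a functor $H\colon\mathcal{C}\times\mathcal{I}_m\to\mathcal{D}$ with $H_0=F$ and $H_m=G$ (equivalently, $F$ and $G$ are joined by a finite zigzag of natural transformations). Categories $\mathcal{C},\mathcal{D}$ are homotopy equivalent if there are functors $F\colon\mathcal{C}\to\mathcal{D}$ and $G\colon\mathcal{D}\to\mathcal{C}$ with $G\circ F\simeq 1_{\mathcal{C}}$ and $F\circ G\simeq 1_{\mathcal{D}}$. A small category is connected if any two objects are joined by a finite zigzag of arrows. Members of covers (subcategories) are not required to be connected. Geometric cover: a collection $\{\mathcal{U}_\lambda\}_{\lambda\in\Lambda}$ of subcategories of $\mathcal{C}$ such that for every sequence of composable arrows $f_1,\dots,f_n$ in $\mathcal{C}$ there is $\lambda\in\Lambda$ such that every $f_i$ belongs to $\mathcal{U}_\lambda$. Categorical LS-category: a subcategory $\mathcal{U}$ of $\mathcal{C}$ is categorical in $\mathcal{C}$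 if the inclusion functor $\mathcal{U}\to\mathcal{C}$ is homotopic to a constant functor onto an object (every object goes to that object, every arrow to its identity). $\mathrm{ccat}(\mathcal{C})$ is the least integer $n\ge 0$ such that $\mathcal{C}$ has a geometric cover formed by $n+1$ categorical subcategories, and $\infty$ if there is none. Categorical complexity: let $\Delta\colon\mathcal{C}\to\mathcal{C}\times\mathcal{C}$ be the diagonal functor. A subcategory $\mathcal{U}$ of $\mathcal{C}\times\mathcal{C}$ is a Farber subcategory if there is a functor $F\colon\mathcal{U}\to\mathcal{C}$ with $\Delta\circ F\simeq i_{\mathcal{U}}$, where $i_{\mathcal{U}}\colon\mathcal{U}\to\mathcal{C}\times\mathcal{C}$ is the inclusion. $\mathrm{cTC}(\mathcal{C})$ is the least integer $n\ge 0$ such that $\mathcal{C}\times\mathcal{C}$ has a geometric cover formed by $n+1$ Farber subcategories, and $\infty$ if there is none. *)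

theory Defs
  imports Main "HOL-Library.Extended_Nat"
begin

text \<open>\<open>Comp C g f\<close> is the composite ``\<open>g\<close> after \<open>f\<close>''; its value is irrelevant
  unless \<open>Cod C f = Dom C g\<close>.\<close>

record ('o, 'a) cat =
  Obj :: "'o set"
  Arr :: "'a set"
  Dom :: "'a \<Rightarrow> 'o"
  Cod :: "'a \<Rightarrow> 'o"
  Ident :: "'o \<Rightarrow> 'a"
  Comp :: "'a \<Rightarrow> 'a \<Rightarrow> 'a"

locale category =
  fixes C :: "('o, 'a) cat"
  assumes Dom_in: "f \<in> Arr C \<Longrightarrow> Dom C f \<in> Obj C"
    and Cod_in: "f \<in> Arr C \<Longrightarrow> Cod C f \<in> Obj C"
    and Ident_in: "x \<in> Obj C \<Longrightarrow> Ident C x \<in> Arr C"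
    and Dom_Ident: "x \<in> Obj C \<Longrightarrow> Dom C (Ident C x) = x"
    and Cod_Ident: "x \<in> Obj C \<Longrightarrow> Cod C (Ident C x) = x"
    and Comp_in: "\<lbrakk>f \<in> Arr C; g \<in> Arr C; Cod C f = Dom C g\<rbrakk> \<Longrightarrow> Comp C g f \<in> Arr C"
    and Dom_Comp: "\<lbrakk>f \<in> Arr C; g \<in> Arr C; Cod C f = Dom C g\<rbrakk> \<Longrightarrow> Dom C (Comp C g f) = Dom C f"
    and Cod_Comp: "\<lbrakk>f \<in> Arr C; g \<in> Arr C; Cod C f = Dom C g\<rbrakk> \<Longrightarrow> Cod C (Comp C g f) = Cod C g"
    and Comp_Ident_right: "f \<in> Arr C \<Longrightarrow> Comp C f (Ident C (Dom C f)) = f"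
    and Comp_Ident_left: "f \<in> Arr C \<Longrightarrow> Comp C (Ident C (Cod C f)) f = f"
    and Comp_assoc: "\<lbrakk>f \<in> Arr C; g \<in> Arr C; h \<in> Arr C; Cod C f = Dom C g; Cod C g = Dom C h\<rbrakk>
      \<Longrightarrow> Comp C h (Comp C g f) = Comp C (Comp C h g) f"

definition connected_cat :: "('o, 'a) cat \<Rightarrow> bool" where
  "connected_cat C \<longleftrightarrow>
     (let R = {(Dom C f, Cod C f) | f. f \<in> Arr C}
      in \<forall>x\<in>Obj C. \<forall>y\<in>Obj C. (x, y) \<in> (R \<union> R\<inverse>)\<^sup>*)"

definition subcategory :: "('o, 'a) cat \<Rightarrow> ('o, 'a) cat \<Rightarrow> bool" where
  "subcategory U C \<longleftrightarrow>
     category U \<and> Obj U \<subseteq> Obj C \<and> Arr U \<subseteq> Arr C \<and>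
     (\<forall>f\<in>Arr U. Dom U f = Dom C f \<and> Cod U f = Cod C f) \<and>
     (\<forall>x\<in>Obj U. Ident U x = Ident C x) \<and>
     (\<forall>f\<in>Arr U. \<forall>g\<in>Arr U. Cod U f = Dom U g \<longrightarrow> Comp U g f = Comp C g f)"

definition prod_cat :: "('o, 'a) cat \<Rightarrow> ('p, 'b) cat \<Rightarrow> ('o \<times> 'p, 'a \<times> 'b) cat" where
  "prod_cat C D =
     \<lparr>Obj = Obj C \<times> Obj D,
      Arr = Arr C \<times> Arr D,
      Dom = (\<lambda>(f, g). (Dom C f, Dom D g)),
      Cod = (\<lambda>(f, g). (Cod C f, Cod D g)),
      Ident = (\<lambda>(x, y). (Ident C x, Ident D y)),
      Comp = (\<lambda>(f', g') (f, g). (Comp C f' f, Comp D g' g))\<rparr>"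

text \<open>There is at most one arrow between two objects of the interval category, so the arrow
  \<open>r \<rightarrow> s\<close> is encoded as the pair \<open>(r, s)\<close>.\<close>

definition interval_cat :: "nat \<Rightarrow> (nat, nat \<times> nat) cat" where
  "interval_cat m =
     \<lparr>Obj = {0..m},
      Arr = {(r, s). r \<le> m \<and> s \<le> m \<and> (r = s \<or> (even r \<and> (r = s + 1 \<or> s = r + 1)))},
      Dom = fst,
      Cod = snd,
      Ident = (\<lambda>r. (r, r)),
      Comp = (\<lambda>g f. (fst f, snd g))\<rparr>"

lemma category_prod_cat:
  assumes "category C" "category D"
  shows "category (prod_cat C D)"
proof -
  interpret C: category C by fact
  interpret D: category D by fact
  show ?thesis
    by unfold_locales
      (auto simp: prod_cat_def C.Dom_in C.Cod_in C.Ident_in C.Dom_Ident C.Cod_Ident C.Comp_in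
        C.Dom_Comp C.Cod_Comp C.Comp_Ident_right C.Comp_Ident_left C.Comp_assoc
        D.Dom_in D.Cod_in D.Ident_in D.Dom_Ident D.Cod_Ident D.Comp_in
        D.Dom_Comp D.Cod_Comp D.Comp_Ident_right D.Comp_Ident_left D.Comp_assoc)
qed

lemma category_interval_cat: "category (interval_cat m)"
  by unfold_locales (auto simp: interval_cat_def)

record ('o, 'a, 'p, 'b) fmap =
  ob :: "'o \<Rightarrow> 'p"
  ar :: "'a \<Rightarrow> 'b"

definition is_functor :: "('o, 'a) cat \<Rightarrow> ('p, 'b) cat \<Rightarrow> ('o, 'a, 'p, 'b) fmap \<Rightarrow> bool" where
  "is_functor C D F \<longleftrightarrow>
     (\<forall>x\<in>Obj C. ob F x \<in> Obj D) \<and>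
     (\<forall>f\<in>Arr C. ar F f \<in> Arr D \<and> Dom D (ar F f) = ob F (Dom C f) \<and>
                 Cod D (ar F f) = ob F (Cod C f)) \<and>
     (\<forall>x\<in>Obj C. ar F (Ident C x) = Ident D (ob F x)) \<and>
     (\<forall>f\<in>Arr C. \<forall>g\<in>Arr C. Cod C f = Dom C g \<longrightarrow> ar F (Comp C g f) = Comp D (ar F g) (ar F f))"

text \<open>Functors are given by total functions on the underlying types; two of them are the same
  functor on \<open>C\<close> iff they agree on the objects and arrows of \<open>C\<close>.\<close>

definition functor_eq :: "('o, 'a) cat \<Rightarrow> ('o, 'a, 'p, 'b) fmap \<Rightarrow> ('o, 'a, 'p, 'b) fmap \<Rightarrow> bool" where
  "functor_eq C F G \<longleftrightarrow> (\<forall>x\<in>Obj C. ob F x = ob G x) \<and> (\<forall>f\<in>Arr C. ar F f = ar G f)"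

text \<open>Since subcategories carry the structure of the ambient category, the identity maps serve
  both as the identity functor and as every inclusion functor.\<close>

definition id_functor :: "('o, 'a, 'o, 'a) fmap" where
  "id_functor = \<lparr>ob = (\<lambda>x. x), ar = (\<lambda>f. f)\<rparr>"

definition comp_functor ::
  "('p, 'b, 'q, 'c) fmap \<Rightarrow> ('o, 'a, 'p, 'b) fmap \<Rightarrow> ('o, 'a, 'q, 'c) fmap" where
  "comp_functor G F = \<lparr>ob = ob G \<circ> ob F, ar = ar G \<circ> ar F\<rparr>"

definition const_functor :: "('p, 'b) cat \<Rightarrow> 'p \<Rightarrow> ('o, 'a, 'p, 'b) fmap" where
  "const_functor D c = \<lparr>ob = (\<lambda>_. c), ar = (\<lambda>_. Ident D c)\<rparr>"

definition diag_functor :: "('o, 'a, 'o \<times> 'o, 'a \<times> 'a) fmap" where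
  "diag_functor = \<lparr>ob = (\<lambda>x. (x, x)), ar = (\<lambda>f. (f, f))\<rparr>"

text \<open>The restriction \<open>H\<^sub>j\<close> of a functor \<open>H\<close> on \<open>C \<times> \<I>\<^sub>m\<close> to level \<open>j\<close>.\<close>

definition level :: "nat \<Rightarrow> ('o \<times> nat, 'a \<times> (nat \<times> nat), 'p, 'b) fmap \<Rightarrow> nat \<Rightarrow> ('o, 'a, 'p, 'b) fmap" where
  "level m H j = \<lparr>ob = (\<lambda>x. ob H (x, j)), ar = (\<lambda>f. ar H (f, Ident (interval_cat m) j))\<rparr>"

definition homotopic ::
  "('o, 'a) cat \<Rightarrow> ('p, 'b) cat \<Rightarrow> ('o, 'a, 'p, 'b) fmap \<Rightarrow> ('o, 'a, 'p, 'b) fmap \<Rightarrow> bool" where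
  "homotopic C D F G \<longleftrightarrow>
     is_functor C D F \<and> is_functor C D G \<and>
     (\<exists>m H. is_functor (prod_cat C (interval_cat m)) D H \<and>
            functor_eq C (level m H 0) F \<and> functor_eq C (level m H m) G)"

definition homotopy_equivalent :: "('o, 'a) cat \<Rightarrow> ('p, 'b) cat \<Rightarrow> bool" where
  "homotopy_equivalent C D \<longleftrightarrow>
     (\<exists>F G. is_functor C D F \<and> is_functor D C G \<and>
            homotopic C C (comp_functor G F) id_functor \<and>
            homotopic D D (comp_functor F G) id_functor)"

definition composable :: "('o, 'a) cat \<Rightarrow> 'a list \<Rightarrow> bool" where
  "composable C fs \<longleftrightarrow> fs \<noteq> [] \<and> set fs \<subseteq> Arr C \<and> successively (\<lambda>f g. Cod C f = Dom C g) fs"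

definition geometric_cover :: "('o, 'a) cat \<Rightarrow> 'i set \<Rightarrow> ('i \<Rightarrow> ('o, 'a) cat) \<Rightarrow> bool" where
  "geometric_cover C \<Lambda> U \<longleftrightarrow>
     (\<forall>l\<in>\<Lambda>. subcategory (U l) C) \<and>
     (\<forall>fs. composable C fs \<longrightarrow> (\<exists>l\<in>\<Lambda>. set fs \<subseteq> Arr (U l)))"

definition categorical :: "('o, 'a) cat \<Rightarrow> ('o, 'a) cat \<Rightarrow> bool" where
  "categorical C U \<longleftrightarrow>
     subcategory U C \<and> (\<exists>c\<in>Obj C. homotopic U C id_functor (const_functor C c))"

definition farber :: "('o, 'a) cat \<Rightarrow> ('o \<times> 'o, 'a \<times> 'a) cat \<Rightarrow> bool" where
  "farber C U \<longleftrightarrow>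
     subcategory U (prod_cat C C) \<and>
     (\<exists>F. is_functor U C F \<and> homotopic U (prod_cat C C) (comp_functor diag_functor F) id_functor)"

text \<open>In \<^typ>\<open>enat\<close> the infimum of the empty set is \<open>\<infinity>\<close>. A family indexed by \<open>{0..n}\<close> may contain
  repetitions, which does not affect the least \<open>n\<close>.\<close>

definition ccat :: "('o, 'a) cat \<Rightarrow> enat" where
  "ccat C = Inf {enat n | n. \<exists>U. geometric_cover C {0..n} U \<and> (\<forall>i\<in>{0..n}. categorical C (U i))}"

definition cTC :: "('o, 'a) cat \<Rightarrow> enat" where
  "cTC C = Inf {enat n | n. \<exists>U. geometric_cover (prod_cat C C) {0..n} U \<and> (\<forall>i\<in>{0..n}. farber C (U i))}"

end

theory Submission imports Defs begin

text \<open>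
  Both invariants count the members of the smallest geometric cover by ``good'' subcategories, and
  good covers can be pulled back. Suppose that \<open>C'\<close> is dominated by \<open>C\<close>, that is, there are functors
  \<open>F : C \<rightarrow> C'\<close> and \<open>G : C' \<rightarrow> C\<close> with \<open>F G \<simeq> 1\<close>. The preimages under \<open>G\<close> of the members of a geometric
  cover of \<open>C\<close> form a geometric cover of \<open>C'\<close>, because \<open>G\<close> maps a composable sequence to a composable
  sequence. If the inclusion of \<open>U\<close> is homotopic to the constant functor at \<open>c\<close>, then on the preimage
  \<open>V\<close> of \<open>U\<close> the inclusion satisfies \<open>i\<^sub>V \<simeq> F G i\<^sub>V = F i\<^sub>U G \<simeq> F c\<close>, so \<open>V\<close> is categorical. If \<open>U\<close> is a
  Farber subcategory of \<open>C \<times> C\<close> with section \<open>S\<close>, then on its preimage \<open>V\<close> under \<open>G \<times> G\<close> the functor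
  \<open>F S (G \<times> G)\<close> is a section, as
  \<open>\<Delta> F S (G \<times> G) = (F \<times> F) \<Delta> S (G \<times> G) \<simeq> (F \<times> F) i\<^sub>U (G \<times> G) = F G \<times> F G \<simeq> i\<^sub>V\<close>.
  Hence domination makes both invariants no larger (\<open>ccat_le_of_dominated\<close>,
  \<open>cTC_le_of_dominated\<close>), and a homotopy equivalence is domination in both directions.

  What this argument consumes is that homotopy is symmetric, transitive and compatible with
  composition and with the product of a functor with itself. The arrows of the interval category
  leave the even objects, so reversing an interval, or glueing another interval to its right end,
  only works when its length is even; \<open>homotopicE_even\<close> arranges this by a constant last step.
\<close>

section \<open>Functors\<close>

lemma is_functor_comp:
  assumes "is_functor C D F" "is_functor D E G"
  shows "is_functor C E (comp_functor G F)"
  using assms by (simp add: is_functor_def comp_functor_def)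

lemma is_functor_id: "is_functor C C id_functor"
  by (simp add: is_functor_def id_functor_def)

lemma is_functor_inclusion:
  assumes "subcategory U C"
  shows "is_functor U C id_functor"
  using assms by (auto simp: is_functor_def id_functor_def subcategory_def)


lemma comp_functor_assoc:
  "comp_functor H (comp_functor G F) = comp_functor (comp_functor H G) F"
  by (simp add: comp_functor_def comp_assoc)

lemma comp_functor_id [simp]:
  "comp_functor F id_functor = F" "comp_functor id_functor F = F"
  by (simp_all add: comp_functor_def id_functor_def comp_def)

lemma comp_functor_const:
  assumes "is_functor C D F" "c \<in> Obj C"
  shows "comp_functor F (comp_functor (const_functor C c) G) = const_functor D (ob F c)"
  using assms by (simp add: is_functor_def comp_functor_def const_functor_def comp_def)

definition prod_functor ::
  "('o, 'a, 'p, 'b) fmap \<Rightarrow> ('q, 'c, 'r, 'd) fmap \<Rightarrow> ('o \<times> 'q, 'a \<times> 'c, 'p \<times> 'r, 'b \<times> 'd) fmap" where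
  "prod_functor F G = \<lparr>ob = map_prod (ob F) (ob G), ar = map_prod (ar F) (ar G)\<rparr>"

lemma is_functor_prod:
  assumes "is_functor C D F" "is_functor C' D' G"
  shows "is_functor (prod_cat C C') (prod_cat D D') (prod_functor F G)"
  using assms by (simp add: is_functor_def prod_functor_def prod_cat_def)

lemma prod_functor_comp:
  "comp_functor (prod_functor F F') (prod_functor G G')
     = prod_functor (comp_functor F G) (comp_functor F' G')"
  by (simp add: comp_functor_def prod_functor_def map_prod.comp)

lemma prod_functor_id: "prod_functor id_functor id_functor = id_functor"
  by (simp add: prod_functor_def id_functor_def map_prod_def)

lemma diag_functor_natural:
  "comp_functor diag_functor F = comp_functor (prod_functor F F) diag_functor"
  by (simp add: comp_functor_def prod_functor_def diag_functor_def comp_def)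

section \<open>Homotopy is an equivalence relation compatible with composition\<close>

lemma homotopicI:
  assumes "is_functor C D F" "is_functor C D G"
    and "is_functor (prod_cat C (interval_cat m)) D H"
    and "functor_eq C (level m H 0) F" "functor_eq C (level m H m) G"
  shows "homotopic C D F G"
  using assms by (auto simp: homotopic_def)

definition interval_map :: "(nat \<Rightarrow> nat) \<Rightarrow> (nat, nat \<times> nat, nat, nat \<times> nat) fmap" where
  "interval_map \<phi> = \<lparr>ob = \<phi>, ar = map_prod \<phi> \<phi>\<rparr>"

text \<open>As there is at most one arrow between two objects, a functor between interval categories is
  a map of objects that preserves the existence of arrows.\<close>

lemma is_functor_interval_map:
  assumes "\<And>j. j \<le> n \<Longrightarrow> \<phi> j \<le> m"
    and "\<And>r s. (r, s) \<in> Arr (interval_cat n) \<Longrightarrow> (\<phi> r, \<phi> s) \<in> Arr (interval_cat m)"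
  shows "is_functor (interval_cat n) (interval_cat m) (interval_map \<phi>)"
  using assms by (auto simp: is_functor_def interval_map_def interval_cat_def)

text \<open>Reparametrization of homotopies along a functor of intervals.\<close>

lemma reindex_homotopy:
  assumes "is_functor (prod_cat C (interval_cat m)) D H"
    and "is_functor (interval_cat n) (interval_cat m) (interval_map \<phi>)"
  obtains H' where "is_functor (prod_cat C (interval_cat n)) D H'"
    and "\<And>j. level n H' j = level m H (\<phi> j)"
proof
  let ?H' = "comp_functor H (prod_functor id_functor (interval_map \<phi>))"
  show "is_functor (prod_cat C (interval_cat n)) D ?H'"
    by (rule is_functor_comp[OF is_functor_prod[OF is_functor_id assms(2)] assms(1)])
  show "level n ?H' j = level m H (\<phi> j)" for j
    by (simp add: level_def comp_functor_def prod_functor_def id_functor_def interval_map_def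
        interval_cat_def comp_def)
qed

lemma homotopicE_even:
  assumes "homotopic C D F G"
  obtains m H where "even m" "is_functor (prod_cat C (interval_cat m)) D H"
    "functor_eq C (level m H 0) F" "functor_eq C (level m H m) G"
proof -
  obtain m H where H: "is_functor (prod_cat C (interval_cat m)) D H"
    "functor_eq C (level m H 0) F" "functor_eq C (level m H m) G"
    using assms by (auto simp: homotopic_def)
  show thesis
  proof (cases "even m")
    case True
    then show thesis using that H by blast
  next
    case False
    \<comment> \<open>Collapse the last edge of the longer interval, so that the homotopy rests at its end.\<close>
    have "is_functor (interval_cat (Suc m)) (interval_cat m) (interval_map (\<lambda>j. min j m))"
      by (rule is_functor_interval_map) (auto simp: interval_cat_def)
    from reindex_homotopy[OF H(1) this] obtain H' where
      "is_functor (prod_cat C (interval_cat (Suc m))) D H'"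
      "\<And>j. level (Suc m) H' j = level m H (min j m)"
      by blast
    with False H show thesis by (intro that[of "Suc m" H']) auto
  qed
qed

lemma homotopic_sym:
  assumes "homotopic C D F G"
  shows "homotopic C D G F"
proof -
  obtain m H where "even m" and H: "is_functor (prod_cat C (interval_cat m)) D H"
    "functor_eq C (level m H 0) F" "functor_eq C (level m H m) G"
    using homotopicE_even[OF assms] by blast
  have "is_functor (interval_cat m) (interval_cat m) (interval_map (\<lambda>j. m - j))"
    using \<open>even m\<close> by (intro is_functor_interval_map) (auto simp: interval_cat_def)
  from reindex_homotopy[OF H(1) this] obtain H' where
    "is_functor (prod_cat C (interval_cat m)) D H'"
    "\<And>j. level m H' j = level m H (m - j)"
    by blast
  with H assms show ?thesis by (intro homotopicI[of C D G F m H']) (auto simp: homotopic_def)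
qed

text \<open>The glued map \<open>K\<close> below uses the first homotopy up to level \<open>m\<close> and the second one from
  there on. It is a functor because two composable arrows of an interval category are never both
  proper, so that they and their composite lie in a common half; the two homotopies agree where
  the halves meet.\<close>

lemma homotopic_trans:
  assumes "homotopic C D F G" "homotopic C D G K" "category C"
  shows "homotopic C D F K"
proof -
  obtain m A where "even m" and A: "is_functor (prod_cat C (interval_cat m)) D A"
    "functor_eq C (level m A 0) F" "functor_eq C (level m A m) G"
    using homotopicE_even[OF assms(1)] by blast
  obtain n B where B: "is_functor (prod_cat C (interval_cat n)) D B"
    "functor_eq C (level n B 0) G" "functor_eq C (level n B n) K"
    using assms(2) by (auto simp: homotopic_def)
  interpret category C by fact
  define H where "H = \<lparr>ob = (\<lambda>(x, j). if j \<le> m then ob A (x, j) else ob B (x, j - m)),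
     ar = (\<lambda>(f, (r, s)). if r \<le> m \<and> s \<le> m then ar A (f, (r, s)) else ar B (f, (r - m, s - m)))\<rparr>"
  have ob_left: "ob H (x, j) = ob A (x, j)" if "j \<le> m" for x j
    using that by (simp add: H_def)
  have ar_left: "ar H (f, (r, s)) = ar A (f, (r, s))" if "r \<le> m" "s \<le> m" for f r s
    using that by (simp add: H_def)
  have ob_meet: "ob A (x, m) = ob B (x, 0)" if "x \<in> Obj C" for x
    using A(3) B(2) that by (simp add: functor_eq_def level_def)
  have ar_meet: "ar A (f, (m, m)) = ar B (f, (0, 0))" if "f \<in> Arr C" for f
    using A(3) B(2) that by (simp add: functor_eq_def level_def interval_cat_def)
  have ob_right: "ob H (x, j) = ob B (x, j - m)" if "m \<le> j" "x \<in> Obj C" for x j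
    using that ob_meet[OF that(2)] by (cases "j = m") (simp_all add: H_def)
  have ar_right: "ar H (f, (r, s)) = ar B (f, (r - m, s - m))"
    if "m \<le> r" "m \<le> s" "f \<in> Arr C" for f r s
    using that ar_meet[OF that(3)] by (cases "r = m \<and> s = m") (auto simp: H_def)
  let ?I = "interval_cat (m + n)"
  have left: "(r, s) \<in> Arr (interval_cat m)" if "(r, s) \<in> Arr ?I" "r \<le> m" "s \<le> m" for r s
    using that by (auto simp: interval_cat_def)
  have right: "(r - m, s - m) \<in> Arr (interval_cat n)" if "(r, s) \<in> Arr ?I" "m \<le> r" "m \<le> s" for r s
    using that \<open>even m\<close> by (auto simp: interval_cat_def)
  have half: "(r \<le> m \<and> s \<le> m) \<or> (m \<le> r \<and> m \<le> s)" if "(r, s) \<in> Arr ?I" for r s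
    using that by (auto simp: interval_cat_def)
  have obA: "ob A (x, j) \<in> Obj D" "ar A (Ident C x, (j, j)) = Ident D (ob A (x, j))"
    if "x \<in> Obj C" "j \<le> m" for x j
    using A(1) that by (auto simp: is_functor_def prod_cat_def interval_cat_def)
  have obB: "ob B (x, j) \<in> Obj D" "ar B (Ident C x, (j, j)) = Ident D (ob B (x, j))"
    if "x \<in> Obj C" "j \<le> n" for x j
    using B(1) that by (auto simp: is_functor_def prod_cat_def interval_cat_def)
  have arA: "ar A (f, (r, s)) \<in> Arr D" "Dom D (ar A (f, (r, s))) = ob A (Dom C f, r)"
    "Cod D (ar A (f, (r, s))) = ob A (Cod C f, s)"
    if "f \<in> Arr C" "(r, s) \<in> Arr (interval_cat m)" for f r s
    using A(1) that by (auto simp: is_functor_def prod_cat_def interval_cat_def)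
  have arB: "ar B (f, (r, s)) \<in> Arr D" "Dom D (ar B (f, (r, s))) = ob B (Dom C f, r)"
    "Cod D (ar B (f, (r, s))) = ob B (Cod C f, s)"
    if "f \<in> Arr C" "(r, s) \<in> Arr (interval_cat n)" for f r s
    using B(1) that by (auto simp: is_functor_def prod_cat_def interval_cat_def)
  have compA: "ar A (Comp C g f, (r, t)) = Comp D (ar A (g, (s, t))) (ar A (f, (r, s)))"
    if "f \<in> Arr C" "g \<in> Arr C" "Cod C f = Dom C g"
      "(r, s) \<in> Arr (interval_cat m)" "(s, t) \<in> Arr (interval_cat m)" for f g r s t
  proof -
    have "\<forall>f\<in>Arr (prod_cat C (interval_cat m)). \<forall>g\<in>Arr (prod_cat C (interval_cat m)).
      Cod (prod_cat C (interval_cat m)) f = Dom (prod_cat C (interval_cat m)) g \<longrightarrow>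
      ar A (Comp (prod_cat C (interval_cat m)) g f) = Comp D (ar A g) (ar A f)"
      using A(1) by (simp add: is_functor_def)
    from this[THEN bspec[of _ _ "(f, (r, s))"], THEN bspec[of _ _ "(g, (s, t))"]] that
    show ?thesis by (simp add: prod_cat_def interval_cat_def)
  qed
  have compB: "ar B (Comp C g f, (r, t)) = Comp D (ar B (g, (s, t))) (ar B (f, (r, s)))"
    if "f \<in> Arr C" "g \<in> Arr C" "Cod C f = Dom C g"
      "(r, s) \<in> Arr (interval_cat n)" "(s, t) \<in> Arr (interval_cat n)" for f g r s t
  proof -
    have "\<forall>f\<in>Arr (prod_cat C (interval_cat n)). \<forall>g\<in>Arr (prod_cat C (interval_cat n)).
      Cod (prod_cat C (interval_cat n)) f = Dom (prod_cat C (interval_cat n)) g \<longrightarrow>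
      ar B (Comp (prod_cat C (interval_cat n)) g f) = Comp D (ar B g) (ar B f)"
      using B(1) by (simp add: is_functor_def)
    from this[THEN bspec[of _ _ "(f, (r, s))"], THEN bspec[of _ _ "(g, (s, t))"]] that
    show ?thesis by (simp add: prod_cat_def interval_cat_def)
  qed
  have obH: "ob H (x, j) \<in> Obj D \<and> ar H (Ident C x, (j, j)) = Ident D (ob H (x, j))"
    if "x \<in> Obj C" "j \<le> m + n" for x j
  proof (cases "j \<le> m")
    case True
    then show ?thesis using that obA by (simp add: ob_left ar_left)
  next
    case False
    then show ?thesis using that obB[of x "j - m"] by (simp add: ob_right ar_right Ident_in)
  qed
  have arH: "ar H (f, (r, s)) \<in> Arr D \<and> Dom D (ar H (f, (r, s))) = ob H (Dom C f, r) \<and>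
     Cod D (ar H (f, (r, s))) = ob H (Cod C f, s)"
    if "f \<in> Arr C" "(r, s) \<in> Arr ?I" for f r s
    using half[OF that(2)]
  proof
    assume "r \<le> m \<and> s \<le> m"
    then show ?thesis using that arA[OF that(1) left] by (simp add: ob_left ar_left)
  next
    assume "m \<le> r \<and> m \<le> s"
    then show ?thesis
      using that arB[OF that(1) right] by (simp add: ob_right ar_right Dom_in Cod_in)
  qed
  have compH: "ar H (Comp C g f, (r, t)) = Comp D (ar H (g, (s, t))) (ar H (f, (r, s)))"
    if fg: "f \<in> Arr C" "g \<in> Arr C" "Cod C f = Dom C g"
      and rst: "(r, s) \<in> Arr ?I" "(s, t) \<in> Arr ?I" for f g r s t
  proof -
    have "r = s \<or> s = t"
      using rst by (auto simp: interval_cat_def)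
    then consider "r \<le> m" "s \<le> m" "t \<le> m" | "m \<le> r" "m \<le> s" "m \<le> t"
      using half[OF rst(1)] half[OF rst(2)] by blast
    then show ?thesis
    proof cases
      case 1
      then show ?thesis using compA[OF fg left[OF rst(1)] left[OF rst(2)]] by (simp add: ar_left)
    next
      case 2
      then show ?thesis
        using compB[OF fg right[OF rst(1)] right[OF rst(2)]] fg by (simp add: ar_right Comp_in)
    qed
  qed
  show ?thesis
  proof (rule homotopicI)
    show "is_functor C D F" "is_functor C D K"
      using assms by (auto simp: homotopic_def)
    have I: "Dom ?I = fst" "Cod ?I = snd" "Ident ?I = (\<lambda>r. (r, r))"
      "Comp ?I = (\<lambda>g f. (fst f, snd g))" "Obj ?I = {0..m + n}"
      by (simp_all add: interval_cat_def)
    show "is_functor (prod_cat C ?I) D H"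
      using obH arH compH by (auto simp: is_functor_def prod_cat_def I)
    show "functor_eq C (level (m + n) H 0) F"
      using A(2) by (simp add: functor_eq_def level_def interval_cat_def ob_left ar_left)
    show "functor_eq C (level (m + n) H (m + n)) K"
      using B(3) by (simp add: functor_eq_def level_def interval_cat_def ob_right ar_right)
  qed
qed

lemma homotopic_comp_left:
  assumes "homotopic C D F G" "is_functor D E K"
  shows "homotopic C E (comp_functor K F) (comp_functor K G)"
proof -
  obtain m H where FG: "is_functor C D F" "is_functor C D G"
    and H: "is_functor (prod_cat C (interval_cat m)) D H"
    "functor_eq C (level m H 0) F" "functor_eq C (level m H m) G"
    using assms(1) by (auto simp: homotopic_def)
  show ?thesis
  proof (rule homotopicI)
    show "is_functor (prod_cat C (interval_cat m)) E (comp_functor K H)"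
      by (rule is_functor_comp[OF H(1) assms(2)])
    show "is_functor C E (comp_functor K F)" "is_functor C E (comp_functor K G)"
      using FG assms(2) by (auto intro: is_functor_comp)
  qed (use H in \<open>auto simp: functor_eq_def level_def comp_functor_def\<close>)
qed

lemma homotopic_comp_right:
  assumes "homotopic C D F G" "is_functor B C K"
  shows "homotopic B D (comp_functor F K) (comp_functor G K)"
proof -
  obtain m H where FG: "is_functor C D F" "is_functor C D G"
    and H: "is_functor (prod_cat C (interval_cat m)) D H"
    "functor_eq C (level m H 0) F" "functor_eq C (level m H m) G"
    using assms(1) by (auto simp: homotopic_def)
  show ?thesis
  proof (rule homotopicI)
    show "is_functor (prod_cat B (interval_cat m)) D (comp_functor H (prod_functor K id_functor))"
      by (rule is_functor_comp[OF is_functor_prod[OF assms(2) is_functor_id] H(1)])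
    have "\<forall>x\<in>Obj B. ob K x \<in> Obj C" "\<forall>f\<in>Arr B. ar K f \<in> Arr C"
      using assms(2) by (auto simp: is_functor_def)
    then show
      "functor_eq B (level m (comp_functor H (prod_functor K id_functor)) 0) (comp_functor F K)"
      "functor_eq B (level m (comp_functor H (prod_functor K id_functor)) m) (comp_functor G K)"
      using H by (auto simp: functor_eq_def level_def comp_functor_def prod_functor_def
          id_functor_def)
  qed (use FG assms(2) in \<open>auto intro: is_functor_comp\<close>)
qed

text \<open>The same homotopy runs in both coordinates at once, so the lengths match.\<close>

lemma homotopic_prod_self:
  assumes "homotopic C D F G"
  shows "homotopic (prod_cat C C) (prod_cat D D) (prod_functor F F) (prod_functor G G)"
proof -
  obtain m H where FG: "is_functor C D F" "is_functor C D G"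
    and H: "is_functor (prod_cat C (interval_cat m)) D H"
    "functor_eq C (level m H 0) F" "functor_eq C (level m H m) G"
    using assms by (auto simp: homotopic_def)
  \<comment> \<open>The functor \<open>(C \<times> C) \<times> I \<rightarrow> (C \<times> I) \<times> (C \<times> I)\<close> that duplicates the parameter.\<close>
  define T :: "(('a \<times> 'a) \<times> nat, ('b \<times> 'b) \<times> nat \<times> nat,
      ('a \<times> nat) \<times> 'a \<times> nat, ('b \<times> nat \<times> nat) \<times> 'b \<times> nat \<times> nat) fmap"
    where "T = \<lparr>ob = (\<lambda>((x, y), j). ((x, j), (y, j))), ar = (\<lambda>((f, g), k). ((f, k), (g, k)))\<rparr>"
  let ?I = "interval_cat m"
  have T: "is_functor (prod_cat (prod_cat C C) ?I) (prod_cat (prod_cat C ?I) (prod_cat C ?I)) T"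
    by (auto simp: is_functor_def T_def prod_cat_def)
  show ?thesis
  proof (rule homotopicI)
    show "is_functor (prod_cat (prod_cat C C) ?I) (prod_cat D D)
       (comp_functor (prod_functor H H) T)"
      by (rule is_functor_comp[OF T is_functor_prod[OF H(1) H(1)]])
    show "is_functor (prod_cat C C) (prod_cat D D) (prod_functor F F)"
      "is_functor (prod_cat C C) (prod_cat D D) (prod_functor G G)"
      using FG by (simp_all add: is_functor_prod)
  qed (use H in \<open>auto simp: functor_eq_def level_def comp_functor_def prod_functor_def T_def
        prod_cat_def\<close>)
qed

section \<open>Pulling back subcategories and geometric covers\<close>

definition preimage_cat ::
  "('o, 'a) cat \<Rightarrow> ('o, 'a, 'p, 'b) fmap \<Rightarrow> ('p, 'b) cat \<Rightarrow> ('o, 'a) cat" where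
  "preimage_cat D G U =
     D\<lparr>Obj := {x \<in> Obj D. ob G x \<in> Obj U}, Arr := {f \<in> Arr D. ar G f \<in> Arr U}\<rparr>"

lemma subcategory_preimage:
  assumes "category D" "is_functor D C G" "subcategory U C"
  shows "subcategory (preimage_cat D G U) D"
proof -
  interpret D: category D by fact
  interpret U: category U using assms(3) by (simp add: subcategory_def)
  have U: "\<And>f. f \<in> Arr U \<Longrightarrow> Dom U f = Dom C f" "\<And>f. f \<in> Arr U \<Longrightarrow> Cod U f = Cod C f"
    "\<And>x. x \<in> Obj U \<Longrightarrow> Ident U x = Ident C x"
    "\<And>f g. f \<in> Arr U \<Longrightarrow> g \<in> Arr U \<Longrightarrow> Cod U f = Dom U g \<Longrightarrow> Comp U g f = Comp C g f"
    using assms(3) by (auto simp: subcategory_def)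
  have G: "\<And>f. f \<in> Arr D \<Longrightarrow> Dom C (ar G f) = ob G (Dom D f)"
    "\<And>f. f \<in> Arr D \<Longrightarrow> Cod C (ar G f) = ob G (Cod D f)"
    "\<And>x. x \<in> Obj D \<Longrightarrow> ar G (Ident D x) = Ident C (ob G x)"
    "\<And>f g. f \<in> Arr D \<Longrightarrow> g \<in> Arr D \<Longrightarrow> Cod D f = Dom D g \<Longrightarrow>
       ar G (Comp D g f) = Comp C (ar G g) (ar G f)"
    using assms(2) by (auto simp: is_functor_def)
  have closed_Dom: "ob G (Dom D f) \<in> Obj U" if "f \<in> Arr D" "ar G f \<in> Arr U" for f
    using U.Dom_in[OF that(2)] U(1)[OF that(2)] G(1)[OF that(1)] by simp
  have closed_Cod: "ob G (Cod D f) \<in> Obj U" if "f \<in> Arr D" "ar G f \<in> Arr U" for f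
    using U.Cod_in[OF that(2)] U(2)[OF that(2)] G(2)[OF that(1)] by simp
  have closed_Ident: "ar G (Ident D x) \<in> Arr U" if "x \<in> Obj D" "ob G x \<in> Obj U" for x
    using U.Ident_in[OF that(2)] U(3)[OF that(2)] G(3)[OF that(1)] by simp
  have closed_Comp: "ar G (Comp D g f) \<in> Arr U"
    if "f \<in> Arr D" "g \<in> Arr D" "Cod D f = Dom D g" "ar G f \<in> Arr U" "ar G g \<in> Arr U" for f g
  proof -
    have "Cod U (ar G f) = Dom U (ar G g)"
      using that by (simp add: U G)
    then show ?thesis
      using U.Comp_in[OF that(4,5)] U(4)[OF that(4,5)] G(4)[OF that(1-3)] by simp
  qed
  have "category (preimage_cat D G U)"
    by unfold_locales
      (auto simp: preimage_cat_def closed_Dom closed_Cod closed_Ident closed_Comp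
        D.Dom_in D.Cod_in D.Ident_in D.Dom_Ident D.Cod_Ident D.Comp_in
        D.Dom_Comp D.Cod_Comp D.Comp_Ident_right D.Comp_Ident_left D.Comp_assoc)
  then show ?thesis
    by (auto simp: subcategory_def preimage_cat_def)
qed

lemma is_functor_preimage:
  assumes "is_functor D C G" "subcategory U C"
  shows "is_functor (preimage_cat D G U) U G"
  using assms by (auto simp: is_functor_def preimage_cat_def subcategory_def)

lemma composable_map:
  assumes "is_functor D C G" "composable D fs"
  shows "composable C (map (ar G) fs)"
proof -
  have "successively (\<lambda>f g. Cod C (ar G f) = Dom C (ar G g)) fs"
  proof (rule successively_mono)
    show "successively (\<lambda>f g. Cod D f = Dom D g) fs"
      using assms(2) by (simp add: composable_def)
    fix f g assume "f \<in> set fs" "g \<in> set fs" "Cod D f = Dom D g"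
    moreover from this have "f \<in> Arr D" "g \<in> Arr D"
      using assms(2) by (auto simp: composable_def)
    ultimately show "Cod C (ar G f) = Dom C (ar G g)"
      using assms(1) by (simp add: is_functor_def)
  qed
  then show ?thesis
    using assms by (auto simp: composable_def is_functor_def successively_map)
qed

lemma geometric_cover_preimage:
  assumes "category D" "is_functor D C G" "geometric_cover C \<Lambda> U"
  shows "geometric_cover D \<Lambda> (\<lambda>l. preimage_cat D G (U l))"
  unfolding geometric_cover_def
proof (intro conjI ballI allI impI)
  show "subcategory (preimage_cat D G (U l)) D" if "l \<in> \<Lambda>" for l
    using assms that by (auto simp: geometric_cover_def intro: subcategory_preimage)
next
  fix fs assume fs: "composable D fs"
  then obtain l where "l \<in> \<Lambda>" "set (map (ar G) fs) \<subseteq> Arr (U l)"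
    using assms(3) composable_map[OF assms(2) fs] by (auto simp: geometric_cover_def)
  with fs show "\<exists>l\<in>\<Lambda>. set fs \<subseteq> Arr (preimage_cat D G (U l))"
    by (auto simp: composable_def preimage_cat_def)
qed

section \<open>Domination\<close>

text \<open>Follow the homotopy from the identity to \<open>F G\<close>, then contract inside \<open>C\<close> and return by \<open>F\<close>.\<close>

lemma categorical_preimage:
  assumes "category D" "is_functor C D F" "is_functor D C G"
    and "homotopic D D (comp_functor F G) id_functor" and "categorical C U"
  shows "categorical D (preimage_cat D G U)"
proof -
  let ?V = "preimage_cat D G U"
  obtain c where U: "subcategory U C" and c: "c \<in> Obj C"
    and contr: "homotopic U C id_functor (const_functor C c)"
    using assms(5) by (auto simp: categorical_def)
  have V: "subcategory ?V D"
    by (rule subcategory_preimage[OF assms(1,3) U])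
  then have catV: "category ?V"
    by (simp add: subcategory_def)
  have "homotopic ?V D id_functor (comp_functor F G)"
    using homotopic_comp_right[OF homotopic_sym[OF assms(4)] is_functor_inclusion[OF V]] by simp
  moreover have "homotopic ?V D (comp_functor F G) (const_functor D (ob F c))"
    using homotopic_comp_left[OF homotopic_comp_right[OF contr is_functor_preimage[OF assms(3) U]]
        assms(2)]
    by (simp add: comp_functor_const[OF assms(2) c])
  ultimately have "homotopic ?V D id_functor (const_functor D (ob F c))"
    by (rule homotopic_trans[OF _ _ catV])
  moreover have "ob F c \<in> Obj D"
    using assms(2) c by (simp add: is_functor_def)
  ultimately show ?thesis
    using V by (auto simp: categorical_def)
qed

text \<open>The homotopy \<open>\<Delta> S \<simeq> i\<^sub>U\<close> can be applied to \<open>\<Delta> F S (G \<times> G)\<close> since the diagonal is natural, which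
  moves \<open>\<Delta>\<close> past \<open>F\<close>.\<close>

lemma farber_preimage:
  assumes "category D" "is_functor C D F" "is_functor D C G"
    and "homotopic D D (comp_functor F G) id_functor" and "farber C U"
  shows "farber D (preimage_cat (prod_cat D D) (prod_functor G G) U)"
proof -
  let ?V = "preimage_cat (prod_cat D D) (prod_functor G G) U"
  obtain S where U: "subcategory U (prod_cat C C)" and S: "is_functor U C S"
    and sec: "homotopic U (prod_cat C C) (comp_functor diag_functor S) id_functor"
    using assms(5) by (auto simp: farber_def)
  have GG: "is_functor (prod_cat D D) (prod_cat C C) (prod_functor G G)"
    and FF: "is_functor (prod_cat C C) (prod_cat D D) (prod_functor F F)"
    using assms(2,3) by (simp_all add: is_functor_prod)
  have V: "subcategory ?V (prod_cat D D)"
    by (rule subcategory_preimage[OF category_prod_cat[OF assms(1,1)] GG U])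
  then have catV: "category ?V"
    by (simp add: subcategory_def)
  have GV: "is_functor ?V U (prod_functor G G)"
    by (rule is_functor_preimage[OF GG U])
  let ?S = "comp_functor (comp_functor F S) (prod_functor G G)"
  have "homotopic ?V (prod_cat D D) (comp_functor diag_functor ?S)
     (prod_functor (comp_functor F G) (comp_functor F G))"
    using homotopic_comp_left[OF homotopic_comp_right[OF sec GV] FF]
    by (simp add: comp_functor_assoc diag_functor_natural[of F] prod_functor_comp)
  moreover have "homotopic ?V (prod_cat D D)
     (prod_functor (comp_functor F G) (comp_functor F G)) id_functor"
    using homotopic_comp_right[OF homotopic_prod_self[OF assms(4)] is_functor_inclusion[OF V]]
    by (simp add: prod_functor_id)
  ultimately have "homotopic ?V (prod_cat D D) (comp_functor diag_functor ?S) id_functor"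
    by (rule homotopic_trans[OF _ _ catV])
  moreover have "is_functor ?V D ?S"
    by (rule is_functor_comp[OF GV is_functor_comp[OF S assms(2)]])
  ultimately show ?thesis
    using V by (auto simp: farber_def)
qed

lemma ccat_le_of_dominated:
  assumes "category D" "is_functor C D F" "is_functor D C G"
    and "homotopic D D (comp_functor F G) id_functor"
  shows "ccat D \<le> ccat C"
  unfolding ccat_def
  by (rule Inf_superset_mono)
    (use geometric_cover_preimage[OF assms(1,3)] categorical_preimage[OF assms] in blast)

lemma cTC_le_of_dominated:
  assumes "category D" "is_functor C D F" "is_functor D C G"
    and "homotopic D D (comp_functor F G) id_functor"
  shows "cTC D \<le> cTC C"
  unfolding cTC_def
  by (rule Inf_superset_mono)
    (use geometric_cover_preimage[OF category_prod_cat[OF assms(1,1)]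
        is_functor_prod[OF assms(3,3)]] farber_preimage[OF assms] in blast)

theorem corollary4p13:
  fixes C :: "('o, 'a) cat" and C' :: "('p, 'b) cat"
  assumes "category C" and "category C'"
    and "connected_cat C" and "connected_cat C'"
    and "homotopy_equivalent C C'"
  shows "ccat C = ccat C' \<and> cTC C = cTC C'"
proof -
  obtain F G where FG: "is_functor C C' F" "is_functor C' C G"
    "homotopic C C (comp_functor G F) id_functor" "homotopic C' C' (comp_functor F G) id_functor"
    using assms(5) by (auto simp: homotopy_equivalent_def)
  show ?thesis
    using ccat_le_of_dominated[OF assms(1) FG(2,1,3)] ccat_le_of_dominated[OF assms(2) FG(1,2,4)]
      cTC_le_of_dominated[OF assms(1) FG(2,1,3)] cTC_le_of_dominated[OF assms(2) FG(1,2,4)]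
    by (simp add: order_antisym)
qed

end
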